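(* Let $\mathcal{L}=[0,1]$, let $G=C^{\infty}(\mathcal{L},\mathrm{SE}(3))$, and let $M$ be the space of smooth Cosserat deformations. The right action $\Phi:M\times G\to M$ defined by $$\Phi(P,\mathbf{g})(z,r)=\bigl(\mathbf{g}(z)^{-1}(p(z)),\;Q_z(R_{\mathbf{g}(z)}\,r)\bigr),\qquad (z,r)\in \mathcal{L}\times \mathrm{SO}(3),$$ for $P\in M$ written as $P(z,r)=(p(z),Q_z(r))$ and $\mathbf{g}\in G$, is transitive and free.
   Context: $F\mathcal{L}=\mathcal{L}\times\mathrm{SO}(3)$ and $F\mathbb{R}^3=\mathbb{R}^3\times\mathrm{SO}(3)$ are the trivial principal $\mathrm{SO}(3)$-bundles, with projections $\pi$ onto $\mathcal{L}$ and $\mathbb{R}^3$ respectively. $M$ is the set of smooth maps $P:F\mathcal{L}\to F\mathbb{R}^3$ such that there is a smooth map $p:\mathcal{L}\to\mathbb{R}^3$ with $\pi\circ P=p\circ\pi$, so that $P(z,r)=(p(z),Q_z(r))$ with $Q_z:\mathrm{SO}(3)\to\mathrm{SO}(3)$, and such that $P(z,qr)=(p(z),Q_z(q)r)$ for all $z\in\mathcal{L}$ and $q,r\in\mathrm{SO}(3)$. $\mathrm{SE}(3)$ is the group of matrices $g=\begin{pmatrix}R_g&u_g\\0&1\end{pmatrix}$ with $R_g\in\mathrm{SO}(3)$, $u_g\in\mathbb{R}^3$. It acts on $\mathbb{R}^3$ by $g(x)=R_gx+u_g$. The group $G$ has pointwise multiplication and inversion: $(\mathbf{g}_1\mathbf{g}_2)(z)=\mathbf{g}_1(z)\mathbf{g}_2(z)$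 and $\mathbf{g}^{-1}(z)=(\mathbf{g}(z))^{-1}$; its neutral element is the constant function $I_4$. Free means that $\Phi(P,\mathbf{g})=P$ for some $P\in M$ implies that $\mathbf{g}$ is the neutral element. Transitive means that for all $P_1,P_2\in M$ there is $\mathbf{g}\in G$ with $\Phi(P_1,\mathbf{g})=P_2$. *)

theory Defs
  imports "HOL-Analysis.Analysis" "HOL-Algebra.Group"
begin

section \<open>Smooth maps between subsets of Euclidean spaces\<close>

text \<open>
  \<open>Ck_on k U f\<close> is meant for open \<open>U\<close>: all iterated directional derivatives of \<open>f\<close> up to order
  \<open>k\<close> exist (as Frechet derivatives in every direction \<open>v\<close>) and are continuous on \<open>U\<close>.
\<close>

primrec Ck_on :: "nat \<Rightarrow> 'a::euclidean_space set \<Rightarrow> ('a \<Rightarrow> 'b::euclidean_space) \<Rightarrow> bool" where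
  "Ck_on 0 U f \<longleftrightarrow> continuous_on U f"
| "Ck_on (Suc k) U f \<longleftrightarrow>
     (\<forall>x\<in>U. f differentiable (at x)) \<and> (\<forall>v. Ck_on k U (\<lambda>x. frechet_derivative f (at x) v))"

text \<open>
  Smoothness on an arbitrary subset \<open>S\<close>: locally, \<open>f\<close> extends to a smooth map on an open subset of
  the ambient space. For embedded submanifolds (possibly with boundary), such as \<open>{0..1}\<close>,
  \<open>{0..1} \<times> SO3\<close> or \<open>SE(3)\<close>, this is the usual notion of a smooth map; a map into an embedded
  submanifold is smooth iff it is smooth as a map into the ambient space.
\<close>

definition smooth_on :: "'a::euclidean_space set \<Rightarrow> ('a \<Rightarrow> 'b::euclidean_space) \<Rightarrow> bool" where
  "smooth_on S f \<longleftrightarrow>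
     (\<forall>x\<in>S. \<exists>U F. open U \<and> x \<in> U \<and> (\<forall>k. Ck_on k U F) \<and> (\<forall>y\<in>U \<inter> S. F y = f y))"


section \<open>The groups \<open>SO(3)\<close> and \<open>SE(3)\<close>\<close>

definition SO3 :: "(real^3^3) set" where
  "SO3 = {R. rotation_matrix R}"

definition se3_matrix :: "real^3^3 \<Rightarrow> real^3 \<Rightarrow> real^4^4" where
  "se3_matrix R u = vector
     [vector [R$1$1, R$1$2, R$1$3, u$1],
      vector [R$2$1, R$2$2, R$2$3, u$2],
      vector [R$3$1, R$3$2, R$3$3, u$3],
      vector [0,     0,     0,     1  ]]"

definition rot :: "real^4^4 \<Rightarrow> real^3^3" where
  "rot g = vector
     [vector [g$1$1, g$1$2, g$1$3],
      vector [g$2$1, g$2$2, g$2$3],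
      vector [g$3$1, g$3$2, g$3$3]]"

definition translation :: "real^4^4 \<Rightarrow> real^3" where
  "translation g = vector [g$1$4, g$2$4, g$3$4]"

definition SE3 :: "(real^4^4) monoid" where
  "SE3 = \<lparr>carrier = {se3_matrix R u |R u. R \<in> SO3}, monoid.mult = (**), one = mat 1\<rparr>"

definition se3_apply :: "real^4^4 \<Rightarrow> real^3 \<Rightarrow> real^3" where
  "se3_apply g x = rot g *v x + translation g"

lemma vector_4:
  "(vector [a, b, c, d] :: 'a::zero^4) $ 1 = a"
  "(vector [a, b, c, d] :: 'a::zero^4) $ 2 = b"
  "(vector [a, b, c, d] :: 'a::zero^4) $ 3 = c"
  "(vector [a, b, c, d] :: 'a::zero^4) $ 4 = d"
  by (simp_all add: vector_def)

lemma rot_se3_matrix: "rot (se3_matrix R u) = R"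
  by (simp add: rot_def se3_matrix_def vector_4 vec_eq_iff forall_3)

lemma translation_se3_matrix: "translation (se3_matrix R u) = u"
  by (simp add: translation_def se3_matrix_def vector_4 vec_eq_iff forall_3)

lemma se3_matrix_mult:
  "se3_matrix R u ** se3_matrix S v = se3_matrix (R ** S) (R *v v + u)"
  by (simp add: se3_matrix_def vector_4 vec_eq_iff forall_4 matrix_matrix_mult_def
      matrix_vector_mult_def sum_4 sum_3)

lemma se3_matrix_one: "se3_matrix (mat 1) 0 = mat 1"
  by (simp add: se3_matrix_def vector_4 vec_eq_iff forall_4 mat_def)

lemma SO3_mult: "R \<in> SO3 \<Longrightarrow> S \<in> SO3 \<Longrightarrow> R ** S \<in> SO3"
  by (simp add: SO3_def rotation_matrix_def orthogonal_matrix_mul det_mul)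

lemma SO3_one: "mat 1 \<in> SO3"
  by (simp add: SO3_def rotation_matrix_def orthogonal_matrix_id)

lemma SO3_transpose: "R \<in> SO3 \<Longrightarrow> transpose R \<in> SO3"
  by (simp add: SO3_def rotation_matrix_def)

lemma group_SE3: "group SE3"
proof (rule groupI)
  show "\<exists>y\<in>carrier SE3. y \<otimes>\<^bsub>SE3\<^esub> g = \<one>\<^bsub>SE3\<^esub>" if "g \<in> carrier SE3" for g
  proof -
    from that obtain R u where g: "g = se3_matrix R u" and R: "R \<in> SO3"
      by (auto simp: SE3_def)
    let ?h = "se3_matrix (transpose R) (- (transpose R *v u))"
    have "?h ** g = mat 1"
      using R by (simp add: g se3_matrix_mult SO3_def rotation_matrix_def orthogonal_matrix_def
          flip: se3_matrix_one)
    then show ?thesis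
      using SO3_transpose[OF R] by (auto simp: SE3_def)
  qed
  show "x \<otimes>\<^bsub>SE3\<^esub> y \<in> carrier SE3" if "x \<in> carrier SE3" "y \<in> carrier SE3" for x y
    using that by (fastforce simp: SE3_def se3_matrix_mult intro: SO3_mult)
  show "\<one>\<^bsub>SE3\<^esub> \<in> carrier SE3"
    using SO3_one by (auto simp: SE3_def simp flip: se3_matrix_one)
qed (auto simp: SE3_def matrix_mul_assoc)


section \<open>The gauge group and Cosserat deformations\<close>

abbreviation L :: "real set" where
  "L \<equiv> {0..1}"

definition FL :: "(real \<times> (real^3^3)) set" where
  "FL = L \<times> SO3"

definition FR3 :: "((real^3) \<times> (real^3^3)) set" where
  "FR3 = UNIV \<times> SO3"

text \<open>
  Maps with domain \<open>L\<close> or \<open>FL\<close> are represented by extensional functions (\<open>undefined\<close>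
  outside the domain), so that equality of such maps is HOL equality.
\<close>

definition gauge_group :: "(real \<Rightarrow> real^4^4) monoid" where
  "gauge_group =
     \<lparr>carrier = {g \<in> L \<rightarrow>\<^sub>E carrier SE3. smooth_on L g},
      monoid.mult = (\<lambda>g h. \<lambda>z\<in>L. g z \<otimes>\<^bsub>SE3\<^esub> h z),
      one = (\<lambda>z\<in>L. \<one>\<^bsub>SE3\<^esub>)\<rparr>"

definition cosserat_deformations :: "(real \<times> (real^3^3) \<Rightarrow> (real^3) \<times> (real^3^3)) set" where
  "cosserat_deformations =
     {P \<in> FL \<rightarrow>\<^sub>E FR3. smooth_on FL P \<and>
        (\<exists>(p :: real \<Rightarrow> real^3) (Q :: real \<Rightarrow> real^3^3 \<Rightarrow> real^3^3).
           smooth_on L p \<and>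
           (\<forall>z\<in>L. \<forall>r\<in>SO3. P (z, r) = (p z, Q z r)) \<and>
           (\<forall>z\<in>L. \<forall>q\<in>SO3. \<forall>r\<in>SO3. P (z, q ** r) = (p z, Q z q ** r)))}"

text \<open>For \<open>P (z, r) = (p z, Q z r)\<close> this is the map \<open>(z, r) \<mapsto> (g(z)\<^sup>-\<^sup>1(p z), Q z (R r))\<close>, \<open>R = rot (g z)\<close>.\<close>

definition cosserat_action ::
    "(real \<times> (real^3^3) \<Rightarrow> (real^3) \<times> (real^3^3)) \<Rightarrow> (real \<Rightarrow> real^4^4)
      \<Rightarrow> (real \<times> (real^3^3) \<Rightarrow> (real^3) \<times> (real^3^3))" where
  "cosserat_action P g =
     (\<lambda>(z, r)\<in>FL. (se3_apply (inv\<^bsub>SE3\<^esub> (g z)) (fst (P (z, r))), snd (P (z, rot (g z) ** r))))"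

lemma cosserat_action_apply:
  assumes "g \<in> carrier gauge_group" "z \<in> L" "r \<in> SO3"
    and "\<And>z r. z \<in> L \<Longrightarrow> r \<in> SO3 \<Longrightarrow> P (z, r) = (p z, Q z r)"
  shows "cosserat_action P g (z, r) = (se3_apply (inv\<^bsub>SE3\<^esub> (g z)) (p z), Q z (rot (g z) ** r))"
proof -
  have "g z \<in> carrier SE3"
    using assms(1,2) by (auto simp: gauge_group_def)
  then have "rot (g z) \<in> SO3"
    by (auto simp: SE3_def rot_se3_matrix)
  then show ?thesis
    using assms by (simp add: cosserat_action_def FL_def SO3_mult)
qed


section \<open>Right actions\<close>

locale right_action = group G for G (structure) +
  fixes X :: "'x set" and \<phi> :: "'x \<Rightarrow> 'a \<Rightarrow> 'x"
  assumes act_closed: "\<lbrakk>x \<in> X; g \<in> carrier G\<rbrakk> \<Longrightarrow> \<phi> x g \<in> X"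
    and act_one: "x \<in> X \<Longrightarrow> \<phi> x \<one> = x"
    and act_mult: "\<lbrakk>x \<in> X; g \<in> carrier G; h \<in> carrier G\<rbrakk> \<Longrightarrow> \<phi> x (g \<otimes> h) = \<phi> (\<phi> x g) h"

locale transitive_right_action = right_action +
  assumes transitive: "\<lbrakk>x \<in> X; y \<in> X\<rbrakk> \<Longrightarrow> \<exists>g\<in>carrier G. \<phi> x g = y"

locale free_right_action = right_action +
  assumes free: "\<lbrakk>x \<in> X; g \<in> carrier G; \<phi> x g = x\<rbrakk> \<Longrightarrow> g = \<one>"

end

theory Submission
  imports Defs
begin

text \<open>
  Equivariance gives \<open>Q\<^sub>z(r) = A\<^sub>z r\<close> with \<open>A\<^sub>z = Q\<^sub>z(1)\<close>, so a Cosserat deformation is a smooth curve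
  \<open>(p, A)\<close> in \<open>\<real>\<^sup>3 \<times> SO(3)\<close>, on which \<open>(R, u)\<close> acts by \<open>(p, A) \<mapsto> (R\<^sup>T (p - u), A R)\<close>. The only gauge
  transformation taking \<open>(p, A)\<close> to \<open>(q, B)\<close> is therefore \<open>R = A\<^sup>T B\<close>, \<open>u = p - R q\<close>. All these
  operations are linear or bilinear, so smoothness only needs the Leibniz rule and composition with
  affine maps, not the general chain rule for higher derivatives.
\<close>

text \<open>As a simp rule it would turn \<open>transpose R *v x\<close> into \<open>x v* R\<close>,
  hiding the products in which \<open>transpose R\<close> has to cancel against
  \<open>R\<close>.\<close>

declare transpose_matrix_vector [simp del]

section \<open>Closure properties of smooth maps\<close>

lemma Ck_on_subset: "Ck_on k U f \<Longrightarrow> V \<subseteq> U \<Longrightarrow> Ck_on k V f"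
  by (induction k arbitrary: f) (auto intro: continuous_on_subset)

lemma Ck_on_Suc_has_derivative:
  "Ck_on (Suc k) U f \<Longrightarrow> x \<in> U \<Longrightarrow> (f has_derivative frechet_derivative f (at x)) (at x)"
  unfolding Ck_on.simps frechet_derivative_works by blast

text \<open>On an open set the derivative at a point depends only on nearby values, so agreement on
  \<open>U\<close> passes to every directional derivative and the induction can continue with
  those.\<close>

lemma Ck_on_cong:
  assumes "open U" "\<And>x. x \<in> U \<Longrightarrow> f x = g x" "Ck_on k U f"
  shows "Ck_on k U g"
  using assms(2,3)
proof (induction k arbitrary: f g)
  case 0
  then show ?case using continuous_on_eq[of U f g] by simp
next
  case (Suc k)
  have der: "(g has_derivative frechet_derivative f (at x)) (at x)" if "x \<in> U" for x
    using Ck_on_Suc_has_derivative[OF Suc.prems(2) that] assms(1) that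
    by (rule has_derivative_transform_within_open) (rule Suc.prems(1))
  have "Ck_on k U (\<lambda>x. frechet_derivative g (at x) v)" for v
  proof (rule Suc.IH)
    show "frechet_derivative f (at x) v = frechet_derivative g (at x) v" if "x \<in> U" for x
      using frechet_derivative_at[OF der[OF that]] by simp
    show "Ck_on k U (\<lambda>x. frechet_derivative f (at x) v)"
      using Suc.prems by simp
  qed
  moreover have "g differentiable (at x)" if "x \<in> U" for x
    using der[OF that] by (rule differentiableI)
  ultimately show ?case by simp
qed

text \<open>Derivatives are unique, so an explicit formula \<open>f'\<close> may replace
  \<open>frechet_derivative\<close>; each closure rule below then only has to supply its
  differentiation formula.\<close>

lemma Ck_on_SucI:
  assumes "open U" "\<And>x. x \<in> U \<Longrightarrow> (f has_derivative f' x) (at x)"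
    and "\<And>v. Ck_on k U (\<lambda>x. f' x v)"
  shows "Ck_on (Suc k) U f"
proof -
  have "Ck_on k U (\<lambda>x. frechet_derivative f (at x) v)" for v
    by (rule Ck_on_cong[OF assms(1) _ assms(3)[of v]])
      (simp flip: frechet_derivative_at[OF assms(2)])
  moreover have "f differentiable (at x)" if "x \<in> U" for x
    using assms(2)[OF that] by (rule differentiableI)
  ultimately show ?thesis by simp
qed

text \<open>\<open>Ck_on\<close> demands continuity only of the derivatives of top order; at lower
  orders it is recovered from differentiability. The Leibniz rule needs this for its
  undifferentiated factors.\<close>

lemma Ck_on_SucD:
  assumes "Ck_on (Suc k) U f"
  shows "Ck_on k U f"
  using assms
proof (induction k arbitrary: f)
  case 0
  then show ?case
    by (simp add: continuous_at_imp_continuous_on differentiable_imp_continuous_within)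
next
  case (Suc k)
  then show ?case
    unfolding Ck_on.simps(2)[of "Suc k"] Ck_on.simps(2)[of k] by blast
qed

lemma Ck_on_const: "open U \<Longrightarrow> Ck_on k U (\<lambda>x. c)"
proof (induction k arbitrary: c)
  case (Suc k)
  then show ?case
    by (intro Ck_on_SucI[where f' = "\<lambda>_ _. 0"] has_derivative_const)
qed simp

text \<open>The derivative is \<open>T\<close> at every point, so the directional derivatives are
  constants and a case distinction replaces the induction.\<close>

lemma Ck_on_linear:
  assumes "open U" "bounded_linear T"
  shows "Ck_on k U T"
proof (cases k)
  case 0
  then show ?thesis
    using assms(2) by (simp add: linear_continuous_on)
next
  case (Suc m)
  then show ?thesis
    using assms
    by (simp del: Ck_on.simps)
      (intro Ck_on_SucI[where f' = "\<lambda>_. T"] Ck_on_const bounded_linear_imp_has_derivative)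
qed

lemma Ck_on_linear_comp:
  assumes "open U" "bounded_linear T" "Ck_on k U f"
  shows "Ck_on k U (\<lambda>x. T (f x))"
  using assms(3)
proof (induction k arbitrary: f)
  case 0
  then show ?case
    using bounded_linear.continuous_on[OF assms(2)] by simp
next
  case (Suc k)
  show ?case
  proof (rule Ck_on_SucI[OF assms(1)])
    show "((\<lambda>x. T (f x)) has_derivative (\<lambda>v. T (frechet_derivative f (at x) v))) (at x)"
      if "x \<in> U" for x
      using Ck_on_Suc_has_derivative[OF Suc.prems that] by (rule bounded_linear.has_derivative[OF assms(2)])
  qed (use Suc in simp)
qed

lemma Ck_on_add:
  assumes "open U" "Ck_on k U f" "Ck_on k U g"
  shows "Ck_on k U (\<lambda>x. f x + g x)"
  using assms(2,3)
proof (induction k arbitrary: f g)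
  case 0
  then show ?case by (simp add: continuous_on_add)
next
  case (Suc k)
  show ?case
  proof (rule Ck_on_SucI[OF assms(1)])
    show "((\<lambda>x. f x + g x) has_derivative
        (\<lambda>v. frechet_derivative f (at x) v + frechet_derivative g (at x) v)) (at x)"
      if "x \<in> U" for x
      using Suc.prems that by (intro has_derivative_add Ck_on_Suc_has_derivative)
  qed (use Suc in simp)
qed

text \<open>By the Leibniz rule a directional derivative is a sum of two terms of the form
  \<open>B\<close> applied to C^k maps, so the induction hypothesis covers both, once the
  undifferentiated factor is lowered from order \<open>Suc k\<close> to \<open>k\<close>.\<close>

lemma Ck_on_bilinear:
  assumes "open U" "bounded_bilinear B" "Ck_on k U f" "Ck_on k U g"
  shows "Ck_on k U (\<lambda>x. B (f x) (g x))"
  using assms(3,4)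
proof (induction k arbitrary: f g)
  case 0
  then show ?case
    using bounded_bilinear.continuous_on[OF assms(2)] by simp
next
  case (Suc k)
  show ?case
  proof (rule Ck_on_SucI[OF assms(1)])
    show "((\<lambda>x. B (f x) (g x)) has_derivative
        (\<lambda>v. B (f x) (frechet_derivative g (at x) v) + B (frechet_derivative f (at x) v) (g x))) (at x)"
      if "x \<in> U" for x
      using Suc.prems that
      by (intro bounded_bilinear.FDERIV[OF assms(2)] Ck_on_Suc_has_derivative)
    show "Ck_on k U (\<lambda>x. B (f x) (frechet_derivative g (at x) v)
        + B (frechet_derivative f (at x) v) (g x))" for v
      using Suc.prems Suc.prems[THEN Ck_on_SucD]
      by (intro Ck_on_add[OF assms(1)] Suc.IH) auto
  qed
qed

text \<open>The derivative of the composite in direction \<open>v\<close> is the derivative of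
  \<open>f\<close> in direction \<open>T v\<close>, again precomposed with the same map. As
  \<open>T v\<close> does not depend on \<open>x\<close>, the induction closes without product
  terms; this is what affine inner maps buy over general ones.\<close>

lemma Ck_on_affine_precomp:
  assumes "open U" "bounded_linear T" "Ck_on k U f"
  shows "Ck_on k ((\<lambda>x. c + T x) -` U) (\<lambda>x. f (c + T x))"
  using assms(3)
proof (induction k arbitrary: f)
  have cont: "continuous_on V (\<lambda>x. c + T x)" for V
    by (intro continuous_intros linear_continuous_on assms)
  then have op: "open ((\<lambda>x. c + T x) -` U)"
    by (intro open_vimage assms)
  {
    case 0
    then show ?case
      by (auto intro: continuous_on_compose2[OF _ cont, of U f])
  next
    case (Suc k)
    show ?case
    proof (rule Ck_on_SucI[OF op])
      show "((\<lambda>x. f (c + T x)) has_derivative (\<lambda>v. frechet_derivative f (at (c + T x)) (T v))) (at x)"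
        if "x \<in> (\<lambda>x. c + T x) -` U" for x
      proof (rule has_derivative_compose[where g = f])
        show "((\<lambda>x. c + T x) has_derivative T) (at x)"
          using has_derivative_add[OF has_derivative_const bounded_linear_imp_has_derivative[OF assms(2)]]
          by auto
        show "(f has_derivative frechet_derivative f (at (c + T x))) (at (c + T x))"
          using Suc.prems that by (intro Ck_on_Suc_has_derivative) auto
      qed
      show "Ck_on k ((\<lambda>x. c + T x) -` U) (\<lambda>x. frechet_derivative f (at (c + T x)) (T v))" for v
        using Suc.prems by (intro Suc.IH) simp
    qed
  }
qed

section \<open>Smooth maps on arbitrary subsets of Euclidean space\<close>

lemma smooth_on_cong:
  "smooth_on S f \<Longrightarrow> (\<And>x. x \<in> S \<Longrightarrow> f x = g x) \<Longrightarrow> smooth_on S g"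
  unfolding smooth_on_def by (metis IntD2)

lemma smooth_on_const: "smooth_on S (\<lambda>x. c)"
  unfolding smooth_on_def using Ck_on_const[OF open_UNIV] by blast

lemma smooth_on_linear: "bounded_linear T \<Longrightarrow> smooth_on S T"
  unfolding smooth_on_def using Ck_on_linear[OF open_UNIV] by blast

lemma smooth_on_linear_comp:
  assumes "bounded_linear T" "smooth_on S f"
  shows "smooth_on S (\<lambda>x. T (f x))"
  unfolding smooth_on_def
proof
  fix x assume "x \<in> S"
  then obtain U F where "open U" "x \<in> U" "\<forall>k. Ck_on k U F" "\<forall>y\<in>U \<inter> S. F y = f y"
    using assms(2) unfolding smooth_on_def by blast
  then show "\<exists>U F. open U \<and> x \<in> U \<and> (\<forall>k. Ck_on k U F) \<and> (\<forall>y\<in>U \<inter> S. F y = T (f y))"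
    by (intro exI[of _ U] exI[of _ "\<lambda>x. T (F x)"]) (auto intro: Ck_on_linear_comp assms(1))
qed

text \<open>Each function brings its own local extension and neighbourhood; on the intersection both
  extensions can be fed to the rules for open sets.\<close>

lemma smooth_on_common_neighbourhood:
  assumes "smooth_on S f" "smooth_on S g" "x \<in> S"
  obtains U F G where "open U" "x \<in> U" "\<forall>k. Ck_on k U F" "\<forall>k. Ck_on k U G"
    "\<forall>y\<in>U \<inter> S. F y = f y" "\<forall>y\<in>U \<inter> S. G y = g y"
proof -
  obtain U F where "open U" "x \<in> U" "\<forall>k. Ck_on k U F" "\<forall>y\<in>U \<inter> S. F y = f y"
    using assms(1,3) unfolding smooth_on_def by blast
  moreover obtain V G where "open V" "x \<in> V" "\<forall>k. Ck_on k V G" "\<forall>y\<in>V \<inter> S. G y = g y"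
    using assms(2,3) unfolding smooth_on_def by blast
  ultimately show thesis
    by (intro that[of "U \<inter> V" F G]) (auto intro: Ck_on_subset)
qed

lemma smooth_on_add:
  assumes "smooth_on S f" "smooth_on S g"
  shows "smooth_on S (\<lambda>x. f x + g x)"
  unfolding smooth_on_def
proof
  fix x assume "x \<in> S"
  with assms obtain U F G where "open U" "x \<in> U" "\<forall>k. Ck_on k U F" "\<forall>k. Ck_on k U G"
    "\<forall>y\<in>U \<inter> S. F y = f y" "\<forall>y\<in>U \<inter> S. G y = g y"
    by (rule smooth_on_common_neighbourhood)
  then show "\<exists>U F. open U \<and> x \<in> U \<and> (\<forall>k. Ck_on k U F) \<and> (\<forall>y\<in>U \<inter> S. F y = f y + g y)"
    by (intro exI[of _ U] exI[of _ "\<lambda>x. F x + G x"]) (auto intro: Ck_on_add)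
qed

lemma smooth_on_bilinear:
  assumes "bounded_bilinear B" "smooth_on S f" "smooth_on S g"
  shows "smooth_on S (\<lambda>x. B (f x) (g x))"
  unfolding smooth_on_def
proof
  fix x assume "x \<in> S"
  with assms(2,3) obtain U F G where "open U" "x \<in> U" "\<forall>k. Ck_on k U F" "\<forall>k. Ck_on k U G"
    "\<forall>y\<in>U \<inter> S. F y = f y" "\<forall>y\<in>U \<inter> S. G y = g y"
    by (rule smooth_on_common_neighbourhood)
  then show "\<exists>U F. open U \<and> x \<in> U \<and> (\<forall>k. Ck_on k U F) \<and> (\<forall>y\<in>U \<inter> S. F y = B (f y) (g y))"
    by (intro exI[of _ U] exI[of _ "\<lambda>x. B (F x) (G x)"]) (auto intro: Ck_on_bilinear assms(1))
qed

lemma smooth_on_uminus: "smooth_on S f \<Longrightarrow> smooth_on S (\<lambda>x. - f x)"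
  using smooth_on_linear_comp[OF bounded_linear_minus[OF bounded_linear_ident]] .

lemma smooth_on_diff:
  assumes "smooth_on S f" "smooth_on S g"
  shows "smooth_on S (\<lambda>x. f x - g x)"
  using smooth_on_add[OF assms(1) smooth_on_uminus[OF assms(2)]] by simp

lemma smooth_on_Pair:
  assumes "smooth_on S f" "smooth_on S g"
  shows "smooth_on S (\<lambda>x. (f x, g x))"
proof -
  \<comment> \<open>Splitting the pair into its two axis components reduces pairing to linear images
    and a sum.\<close>
  have "smooth_on S (\<lambda>x. (f x, 0) + (0, g x))"
    by (intro smooth_on_add smooth_on_linear_comp[OF _ assms(1)] smooth_on_linear_comp[OF _ assms(2)]
        bounded_linear_Pair bounded_linear_ident bounded_linear_zero)
  then show ?thesis by simp
qed

text \<open>Serves for moving between \<open>L\<close> and \<open>FL\<close>: the projection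
  \<open>fst\<close> and the section sending \<open>z\<close> to \<open>(z, mat 1)\<close> are both
  affine. A local extension of \<open>f\<close> is pulled back together with its
  neighbourhood.\<close>

lemma smooth_on_affine_precomp:
  assumes "bounded_linear T" "smooth_on S f" "\<And>x. x \<in> S' \<Longrightarrow> c + T x \<in> S"
  shows "smooth_on S' (\<lambda>x. f (c + T x))"
  unfolding smooth_on_def
proof
  fix x assume "x \<in> S'"
  then have "c + T x \<in> S" by (rule assms(3))
  then obtain U F where UF: "open U" "c + T x \<in> U" "\<forall>k. Ck_on k U F" "\<forall>y\<in>U \<inter> S. F y = f y"
    using assms(2) unfolding smooth_on_def by blast
  have "continuous_on UNIV (\<lambda>x. c + T x)"
    by (intro continuous_intros linear_continuous_on assms)
  then have "open ((\<lambda>x. c + T x) -` U)"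
    by (intro open_vimage UF)
  then show "\<exists>V F. open V \<and> x \<in> V \<and> (\<forall>k. Ck_on k V F) \<and> (\<forall>y\<in>V \<inter> S'. F y = f (c + T y))"
    using UF assms(3)
    by (intro exI[of _ "(\<lambda>x. c + T x) -` U"] exI[of _ "\<lambda>x. F (c + T x)"])
      (auto intro: Ck_on_affine_precomp assms(1))
qed

section \<open>Matrix operations as linear, bilinear and affine maps\<close>

lemma bounded_bilinear_matrix_mult:
  "bounded_bilinear ((**) :: real^'n^'m \<Rightarrow> real^'k^'n \<Rightarrow> real^'k^'m)"
  unfolding bilinear_conv_bounded_bilinear[symmetric] bilinear_def
  by (auto intro!: linearI simp: matrix_matrix_mult_def vec_eq_iff algebra_simps sum.distrib
      sum_distrib_left)

lemma bounded_bilinear_matrix_vector_mult: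
  "bounded_bilinear ((*v) :: real^'n^'m \<Rightarrow> real^'n \<Rightarrow> real^'m)"
  unfolding bilinear_conv_bounded_bilinear[symmetric] bilinear_def
  by (auto intro!: linearI simp: matrix_vector_mult_def vec_eq_iff algebra_simps sum.distrib
      sum_distrib_left)

lemma bounded_linear_transpose: "bounded_linear (transpose :: real^'n^'m \<Rightarrow> real^'m^'n)"
  unfolding linear_conv_bounded_linear[symmetric]
  by (auto intro!: linearI simp: transpose_def vec_eq_iff)

lemma bounded_linear_rot: "bounded_linear rot"
  unfolding linear_conv_bounded_linear[symmetric]
  by (auto intro!: linearI simp: rot_def vec_eq_iff forall_3)

lemma bounded_linear_translation: "bounded_linear translation"
  unfolding linear_conv_bounded_linear[symmetric]
  by (auto intro!: linearI simp: translation_def vec_eq_iff forall_3)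

lemma smooth_on_se3_matrix:
  assumes "smooth_on S R" "smooth_on S u"
  shows "smooth_on S (\<lambda>z. se3_matrix (R z) (u z))"
proof -
  \<comment> \<open>The bottom right entry 1 makes \<open>se3_matrix\<close> affine; subtracting its
    value at the origin leaves a linear map, and the constant is added back afterwards.\<close>
  let ?T = "\<lambda>(R, u). se3_matrix R u - se3_matrix 0 0"
  have "bounded_linear ?T"
    unfolding linear_conv_bounded_linear[symmetric]
    by (auto intro!: linearI simp: se3_matrix_def vec_eq_iff forall_4 vector_4)
  from smooth_on_add[OF smooth_on_linear_comp[OF this smooth_on_Pair[OF assms]] smooth_on_const]
  have "smooth_on S (\<lambda>z. ?T (R z, u z) + se3_matrix 0 0)" .
  then show ?thesis by simp
qed


section \<open>Normal forms\<close>

definition se3_gauge :: "(real \<Rightarrow> real^3^3) \<Rightarrow> (real \<Rightarrow> real^3) \<Rightarrow> real \<Rightarrow> real^4^4" where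
  "se3_gauge R u = (\<lambda>z\<in>L. se3_matrix (R z) (u z))"

definition deformation ::
    "(real \<Rightarrow> real^3) \<Rightarrow> (real \<Rightarrow> real^3^3) \<Rightarrow> real \<times> (real^3^3) \<Rightarrow> (real^3) \<times> (real^3^3)" where
  "deformation p A = (\<lambda>(z, r)\<in>FL. (p z, A z ** r))"

text \<open>Values outside \<open>L\<close> are left free, so pointwise products and transposes of
  frames are again frames without any restriction operator.\<close>

definition smooth_frame :: "(real \<Rightarrow> real^3^3) \<Rightarrow> bool" where
  "smooth_frame A \<longleftrightarrow> smooth_on L A \<and> A \<in> L \<rightarrow> SO3"

lemma SO3_transpose_mult:
  assumes "R \<in> SO3"
  shows "transpose R ** R = mat 1" "R ** transpose R = mat 1"
  using assms by (simp_all add: SO3_def rotation_matrix_def orthogonal_matrix_def)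

lemma smooth_frame_one: "smooth_frame (\<lambda>z. mat 1)"
  by (simp add: smooth_frame_def smooth_on_const SO3_one)

lemma smooth_frame_transpose: "smooth_frame A \<Longrightarrow> smooth_frame (\<lambda>z. transpose (A z))"
  by (auto simp: smooth_frame_def SO3_transpose Pi_iff smooth_on_linear_comp[OF bounded_linear_transpose])

lemma smooth_frame_mult:
  "smooth_frame A \<Longrightarrow> smooth_frame B \<Longrightarrow> smooth_frame (\<lambda>z. A z ** B z)"
  by (auto simp: smooth_frame_def SO3_mult Pi_iff smooth_on_bilinear[OF bounded_bilinear_matrix_mult])

lemma smooth_on_frame_apply:
  "smooth_frame A \<Longrightarrow> smooth_on L u \<Longrightarrow> smooth_on L (\<lambda>z. A z *v u z)"
  by (auto simp: smooth_frame_def smooth_on_bilinear[OF bounded_bilinear_matrix_vector_mult])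

section \<open>The gauge group in coordinates\<close>

lemma carrier_gauge_group:
  "g \<in> carrier gauge_group \<longleftrightarrow> (\<exists>R u. smooth_frame R \<and> smooth_on L u \<and> g = se3_gauge R u)"
proof
  assume g: "g \<in> carrier gauge_group"
  then have smooth: "smooth_on L g" and ext: "g \<in> extensional L"
    and rep: "\<And>z. z \<in> L \<Longrightarrow> \<exists>R u. g z = se3_matrix R u \<and> R \<in> SO3"
    by (auto simp: gauge_group_def SE3_def PiE_def Pi_iff)
  \<comment> \<open>The coordinates are read off by the linear maps \<open>rot\<close> and
    \<open>translation\<close>, hence inherit smoothness from \<open>g\<close>.\<close>
  have "g = se3_gauge (\<lambda>z. rot (g z)) (\<lambda>z. translation (g z))"
  proof (rule extensionalityI[OF ext])
    show "g z = se3_gauge (\<lambda>z. rot (g z)) (\<lambda>z. translation (g z)) z" if "z \<in> L" for z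
      using rep[OF that] that by (auto simp: se3_gauge_def rot_se3_matrix translation_se3_matrix)
  qed (simp add: se3_gauge_def)
  moreover have "rot (g z) \<in> SO3" if "z \<in> L" for z
    using rep[OF that] by (auto simp: rot_se3_matrix)
  then have "smooth_frame (\<lambda>z. rot (g z))"
    by (auto simp: smooth_frame_def smooth_on_linear_comp[OF bounded_linear_rot smooth])
  moreover have "smooth_on L (\<lambda>z. translation (g z))"
    by (rule smooth_on_linear_comp[OF bounded_linear_translation smooth])
  ultimately show "\<exists>R u. smooth_frame R \<and> smooth_on L u \<and> g = se3_gauge R u"
    by blast
next
  assume "\<exists>R u. smooth_frame R \<and> smooth_on L u \<and> g = se3_gauge R u"
  then obtain R u where Ru: "smooth_frame R" "smooth_on L u" and g: "g = se3_gauge R u"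
    by blast
  have "smooth_on L g"
    by (rule smooth_on_cong[OF smooth_on_se3_matrix[of L R u]])
      (use Ru in \<open>auto simp: g se3_gauge_def smooth_frame_def\<close>)
  then show "g \<in> carrier gauge_group"
    using Ru by (auto simp: gauge_group_def g se3_gauge_def SE3_def smooth_frame_def Pi_iff)
qed

lemma se3_gauge_closed:
  "smooth_frame R \<Longrightarrow> smooth_on L u \<Longrightarrow> se3_gauge R u \<in> carrier gauge_group"
  unfolding carrier_gauge_group by blast

text \<open>The semidirect product law is a block matrix identity, valid for arbitrary
  \<open>R\<close> and \<open>S\<close>, so it can rewrite without side conditions.\<close>

lemma gauge_group_mult:
  "se3_gauge R u \<otimes>\<^bsub>gauge_group\<^esub> se3_gauge S v = se3_gauge (\<lambda>z. R z ** S z) (\<lambda>z. R z *v v z + u z)"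
  by (auto simp: gauge_group_def se3_gauge_def SE3_def se3_matrix_mult)

lemma gauge_group_one: "\<one>\<^bsub>gauge_group\<^esub> = se3_gauge (\<lambda>z. mat 1) (\<lambda>z. 0)"
  by (simp add: gauge_group_def se3_gauge_def SE3_def se3_matrix_one)

text \<open>Orthogonality of \<open>R z\<close> is known only for \<open>z\<close> in
  \<open>L\<close>; the restriction in \<open>se3_gauge\<close> makes identities on \<open>L\<close>
  sufficient.\<close>

lemma se3_gauge_cong:
  "(\<And>z. z \<in> L \<Longrightarrow> R z = S z) \<Longrightarrow> (\<And>z. z \<in> L \<Longrightarrow> u z = v z) \<Longrightarrow> se3_gauge R u = se3_gauge S v"
  by (auto simp: se3_gauge_def)

lemma group_gauge_group: "group gauge_group"
proof (rule groupI)
  show "\<one>\<^bsub>gauge_group\<^esub> \<in> carrier gauge_group"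
    unfolding gauge_group_one by (intro se3_gauge_closed smooth_frame_one smooth_on_const)
next
  fix g h assume "g \<in> carrier gauge_group" "h \<in> carrier gauge_group"
  then obtain R u S v where "smooth_frame R" "smooth_on L u" "g = se3_gauge R u"
    "smooth_frame S" "smooth_on L v" "h = se3_gauge S v"
    unfolding carrier_gauge_group by blast
  then show "g \<otimes>\<^bsub>gauge_group\<^esub> h \<in> carrier gauge_group"
    by (simp add: gauge_group_mult se3_gauge_closed smooth_frame_mult smooth_on_add
        smooth_on_frame_apply)
next
  fix g h k
  assume "g \<in> carrier gauge_group" "h \<in> carrier gauge_group" "k \<in> carrier gauge_group"
  then show "g \<otimes>\<^bsub>gauge_group\<^esub> h \<otimes>\<^bsub>gauge_group\<^esub> k
      = g \<otimes>\<^bsub>gauge_group\<^esub> (h \<otimes>\<^bsub>gauge_group\<^esub> k)"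
    unfolding carrier_gauge_group
    by (auto simp: gauge_group_mult matrix_mul_assoc matrix_vector_mul_assoc
        matrix_vector_right_distrib add.assoc)
next
  fix g assume "g \<in> carrier gauge_group"
  then show "\<one>\<^bsub>gauge_group\<^esub> \<otimes>\<^bsub>gauge_group\<^esub> g = g"
    unfolding carrier_gauge_group by (auto simp: gauge_group_mult gauge_group_one)
next
  fix g assume "g \<in> carrier gauge_group"
  then obtain R u where Ru: "smooth_frame R" "smooth_on L u" and g: "g = se3_gauge R u"
    unfolding carrier_gauge_group by blast
  \<comment> \<open>The inverse rigid motion: solving \<open>transpose R *v u + v = 0\<close> for
    the translation part \<open>v\<close>.\<close>
  let ?h = "se3_gauge (\<lambda>z. transpose (R z)) (\<lambda>z. - (transpose (R z) *v u z))"
  have "?h \<otimes>\<^bsub>gauge_group\<^esub> g = \<one>\<^bsub>gauge_group\<^esub>"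
    unfolding g gauge_group_mult gauge_group_one
    by (rule se3_gauge_cong) (use Ru in \<open>auto simp: smooth_frame_def Pi_iff SO3_transpose_mult\<close>)
  moreover have "?h \<in> carrier gauge_group"
    by (intro se3_gauge_closed smooth_on_uminus smooth_on_frame_apply smooth_frame_transpose Ru)
  ultimately show "\<exists>h\<in>carrier gauge_group. h \<otimes>\<^bsub>gauge_group\<^esub> g = \<one>\<^bsub>gauge_group\<^esub>"
    by blast
qed

section \<open>Cosserat deformations in coordinates\<close>

lemma deformation_cong:
  "(\<And>z. z \<in> L \<Longrightarrow> p z = q z) \<Longrightarrow> (\<And>z. z \<in> L \<Longrightarrow> A z = B z) \<Longrightarrow>
    deformation p A = deformation q B"
  by (auto simp: deformation_def FL_def)

lemma deformation_eq_iff: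
  "deformation p A = deformation q B \<longleftrightarrow> (\<forall>z\<in>L. p z = q z \<and> A z = B z)" (is "?l \<longleftrightarrow> ?r")
proof
  assume eq: ?l
  \<comment> \<open>Evaluating at the identity rotation recovers the frame.\<close>
  have "p z = q z \<and> A z = B z" if "z \<in> L" for z
    using fun_cong[OF eq, of "(z, mat 1)"] that by (simp add: deformation_def FL_def SO3_one)
  then show ?r by blast
qed (auto intro: deformation_cong)

text \<open>Besides equivariance, smoothness has to be transferred: from \<open>P\<close> to the
  frame by restricting to the section \<open>r = mat 1\<close>, and back because the matrix product
  is bilinear.\<close>

lemma cosserat_deformations_iff:
  "P \<in> cosserat_deformations \<longleftrightarrow>
    (\<exists>p A. smooth_on L p \<and> smooth_frame A \<and> P = deformation p A)"
proof
  assume "P \<in> cosserat_deformations"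
  then obtain p Q where P: "P \<in> FL \<rightarrow>\<^sub>E FR3" "smooth_on FL P" and p: "smooth_on L p"
    and PQ: "\<And>z r. z \<in> L \<Longrightarrow> r \<in> SO3 \<Longrightarrow> P (z, r) = (p z, Q z r)"
    and eqv: "\<And>z q r. z \<in> L \<Longrightarrow> q \<in> SO3 \<Longrightarrow> r \<in> SO3 \<Longrightarrow> P (z, q ** r) = (p z, Q z q ** r)"
    unfolding cosserat_deformations_def by blast
  have "P = deformation p (\<lambda>z. Q z (mat 1))"
  proof (rule extensionalityI[of _ FL])
    show "P x = deformation p (\<lambda>z. Q z (mat 1)) x" if "x \<in> FL" for x
      using eqv[OF _ SO3_one, of "fst x" "snd x"] that by (auto simp: deformation_def FL_def)
  qed (use P in \<open>auto simp: deformation_def PiE_def\<close>)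
  moreover have "smooth_frame (\<lambda>z. Q z (mat 1))"
    unfolding smooth_frame_def
  proof
    \<comment> \<open>Shifted by the constant \<open>(0, mat 1)\<close>, this linear map is the
      section of \<open>FL\<close> along which \<open>P\<close> is restricted.\<close>
    have "bounded_linear (\<lambda>z::real. (z, 0 :: real^3^3))"
      by (intro bounded_linear_Pair bounded_linear_ident bounded_linear_zero)
    from smooth_on_affine_precomp[OF this P(2), of L "(0, mat 1)"]
    have "smooth_on L (\<lambda>z. P (z, mat 1))"
      by (simp add: FL_def SO3_one)
    then show "smooth_on L (\<lambda>z. Q z (mat 1))"
      by (rule smooth_on_cong[OF smooth_on_linear_comp[OF bounded_linear_snd]])
        (simp add: PQ SO3_one)
    show "(\<lambda>z. Q z (mat 1)) \<in> L \<rightarrow> SO3"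
    proof
      fix z assume z: "z \<in> L"
      then have "P (z, mat 1) \<in> FR3"
        using P(1) by (auto simp: FL_def SO3_one)
      then show "Q z (mat 1) \<in> SO3"
        using PQ[OF z SO3_one] by (simp add: FR3_def)
    qed
  qed
  ultimately show "\<exists>p A. smooth_on L p \<and> smooth_frame A \<and> P = deformation p A"
    using p by blast
next
  assume "\<exists>p A. smooth_on L p \<and> smooth_frame A \<and> P = deformation p A"
  then obtain p A where p: "smooth_on L p" and A: "smooth_frame A" and P: "P = deformation p A"
    by blast
  \<comment> \<open>Curves on \<open>L\<close> are pulled back to \<open>FL\<close> along the linear
    projection \<open>fst\<close>.\<close>
  have lift: "smooth_on FL (\<lambda>x. f (fst x))" if "smooth_on L f" for f :: "real \<Rightarrow> 'b::euclidean_space"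
    using smooth_on_affine_precomp[OF bounded_linear_fst that, of FL 0] by (auto simp: FL_def)
  have "smooth_on FL (\<lambda>x. (p (fst x), A (fst x) ** snd x))"
    using A unfolding smooth_frame_def
    by (intro smooth_on_Pair smooth_on_bilinear[OF bounded_bilinear_matrix_mult] lift p
        smooth_on_linear[OF bounded_linear_snd]) simp
  then have "smooth_on FL P"
    by (rule smooth_on_cong) (auto simp: P deformation_def)
  moreover have "P \<in> FL \<rightarrow>\<^sub>E FR3"
    using A by (auto simp: P deformation_def FL_def FR3_def smooth_frame_def SO3_mult Pi_iff)
  moreover have "P (z, r) = (p z, A z ** r)" if "z \<in> L" "r \<in> SO3" for z r
    using that by (simp add: P deformation_def FL_def)
  ultimately show "P \<in> cosserat_deformations"
    unfolding cosserat_deformations_def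
    \<comment> \<open>With \<open>Q z r = A z ** r\<close>, equivariance is associativity of the
      matrix product.\<close>
    using p by (auto intro!: exI[of _ p] exI[of _ "\<lambda>z r. A z ** r"] simp: SO3_mult matrix_mul_assoc)
qed

lemma deformation_closed:
  "smooth_on L p \<Longrightarrow> smooth_frame A \<Longrightarrow> deformation p A \<in> cosserat_deformations"
  unfolding cosserat_deformations_iff by blast

section \<open>The right action in coordinates\<close>

lemma se3_apply_inv:
  assumes "R \<in> SO3"
  shows "se3_apply (inv\<^bsub>SE3\<^esub> (se3_matrix R u)) x = transpose R *v (x - u)"
proof -
  interpret group SE3 by (rule group_SE3)
  let ?h = "se3_matrix (transpose R) (- (transpose R *v u))"
  have "?h \<otimes>\<^bsub>SE3\<^esub> se3_matrix R u = \<one>\<^bsub>SE3\<^esub>"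
    by (simp add: SE3_def se3_matrix_mult SO3_transpose_mult assms flip: se3_matrix_one)
  moreover have "se3_matrix R u \<in> carrier SE3" "?h \<in> carrier SE3"
    using assms SO3_transpose by (auto simp: SE3_def)
  ultimately have "inv\<^bsub>SE3\<^esub> (se3_matrix R u) = ?h"
    by (rule inv_equality)
  then show ?thesis
    by (simp add: se3_apply_def rot_se3_matrix translation_se3_matrix matrix_vector_mult_diff_distrib)
qed

text \<open>The rotation acts on the argument of \<open>Q\<close>, so associativity turns
  \<open>A z ** (R z ** r)\<close> into left multiplication by the new frame
  \<open>A z ** R z\<close>, while the base curve moves by the inverse rigid motion.\<close>

lemma cosserat_action_normal_form:
  assumes "smooth_frame R"
  shows "cosserat_action (deformation p A) (se3_gauge R u)
    = deformation (\<lambda>z. transpose (R z) *v (p z - u z)) (\<lambda>z. A z ** R z)"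
  using assms
  by (auto simp: cosserat_action_def deformation_def se3_gauge_def FL_def smooth_frame_def Pi_iff
      se3_apply_inv rot_se3_matrix SO3_mult matrix_mul_assoc)

lemma right_action_cosserat: "right_action gauge_group cosserat_deformations cosserat_action"
proof (intro right_action.intro right_action_axioms.intro group_gauge_group)
  fix P g assume "P \<in> cosserat_deformations" "g \<in> carrier gauge_group"
  then obtain p A R u where "smooth_on L p" "smooth_frame A" "P = deformation p A"
    "smooth_frame R" "smooth_on L u" "g = se3_gauge R u"
    unfolding cosserat_deformations_iff carrier_gauge_group by blast
  then show "cosserat_action P g \<in> cosserat_deformations"
    by (simp add: cosserat_action_normal_form deformation_closed smooth_on_frame_apply
        smooth_frame_transpose smooth_on_diff smooth_frame_mult)
next
  fix P assume "P \<in> cosserat_deformations"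
  then show "cosserat_action P \<one>\<^bsub>gauge_group\<^esub> = P"
    unfolding cosserat_deformations_iff
    by (auto simp: gauge_group_one cosserat_action_normal_form smooth_frame_one)
next
  fix P g h
  assume "P \<in> cosserat_deformations" "g \<in> carrier gauge_group" "h \<in> carrier gauge_group"
  then obtain p A R u S v where *: "P = deformation p A" "g = se3_gauge R u" "h = se3_gauge S v"
    "smooth_frame R" "smooth_frame S"
    unfolding cosserat_deformations_iff carrier_gauge_group by blast
  \<comment> \<open>Undoing the composite motion means undoing \<open>g\<close> first and then
    \<open>h\<close>. After expansion the only nontrivial term is
    \<open>transpose (R z) *v (R z *v v z)\<close>, which orthogonality reduces to
    \<open>v z\<close>.\<close>
  have "transpose (R z ** S z) *v (p z - (R z *v v z + u z))
      = transpose (S z) *v (transpose (R z) *v (p z - u z) - v z)" if "z \<in> L" for z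
  proof -
    have "R z \<in> SO3"
      using *(4) that by (auto simp: smooth_frame_def)
    then have "transpose (R z) *v (R z *v v z) = v z"
      by (simp add: matrix_vector_mul_assoc SO3_transpose_mult)
    then show ?thesis
      by (simp add: matrix_transpose_mul matrix_vector_mul_assoc[symmetric]
          matrix_vector_mult_diff_distrib matrix_vector_right_distrib)
  qed
  then show "cosserat_action P (g \<otimes>\<^bsub>gauge_group\<^esub> h) = cosserat_action (cosserat_action P g) h"
    using * by (simp add: gauge_group_mult cosserat_action_normal_form smooth_frame_mult
        deformation_eq_iff matrix_mul_assoc)
qed

section \<open>Transitivity and freeness\<close>

lemma cosserat_action_transitive:
  assumes "P \<in> cosserat_deformations" "P' \<in> cosserat_deformations"
  shows "\<exists>g\<in>carrier gauge_group. cosserat_action P g = P'"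
proof -
  obtain p A q B where *: "smooth_on L p" "smooth_frame A" "P = deformation p A"
    "smooth_on L q" "smooth_frame B" "P' = deformation q B"
    using assms unfolding cosserat_deformations_iff by blast
  \<comment> \<open>\<open>R\<close> solves the frame equation \<open>A z ** R z = B z\<close>;
    given \<open>R\<close>, \<open>u\<close> solves
    \<open>transpose (R z) *v (p z - u z) = q z\<close>. Inverting by transposition keeps both
    solutions smooth.\<close>
  define R where "R z = transpose (A z) ** B z" for z
  define u where "u z = p z - R z *v q z" for z
  have R: "smooth_frame R"
    unfolding R_def by (intro smooth_frame_mult smooth_frame_transpose *)
  have u: "smooth_on L u"
    unfolding u_def by (intro smooth_on_diff smooth_on_frame_apply * R)
  have "transpose (R z) *v (p z - u z) = q z" "A z ** R z = B z" if "z \<in> L" for z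
  proof -
    have "R z \<in> SO3" "A z \<in> SO3"
      using R *(2) that by (auto simp: smooth_frame_def)
    then show "transpose (R z) *v (p z - u z) = q z" "A z ** R z = B z"
      \<comment> \<open>The base equation needs only orthogonality of \<open>R z\<close>, so
        \<open>R\<close> stays folded there; the frame equation unfolds it and cancels
        \<open>A z\<close> against its transpose.\<close>
      by (simp_all add: u_def matrix_vector_mul_assoc SO3_transpose_mult)
        (simp add: R_def matrix_mul_assoc SO3_transpose_mult)
  qed
  then have "cosserat_action P (se3_gauge R u) = P'"
    by (simp add: * R cosserat_action_normal_form deformation_eq_iff)
  then show ?thesis
    using se3_gauge_closed[OF R u] by blast
qed

lemma cosserat_action_free:
  assumes "P \<in> cosserat_deformations" "g \<in> carrier gauge_group" "cosserat_action P g = P"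
  shows "g = \<one>\<^bsub>gauge_group\<^esub>"
proof -
  obtain p A R u where *: "smooth_frame A" "P = deformation p A" "smooth_frame R" "g = se3_gauge R u"
    using assms(1,2) unfolding cosserat_deformations_iff carrier_gauge_group by blast
  have "R z = mat 1 \<and> u z = 0" if z: "z \<in> L" for z
  proof -
    have eqs: "transpose (R z) *v (p z - u z) = p z" "A z ** R z = A z"
      using assms(3) z by (auto simp: * cosserat_action_normal_form deformation_eq_iff)
    have "A z \<in> SO3"
      using *(1) z by (auto simp: smooth_frame_def)
    \<comment> \<open>Orthogonality of \<open>A z\<close> allows cancelling it on the left of
      \<open>A z ** R z = A z\<close>.\<close>
    then have "R z = transpose (A z) ** (A z ** R z)"
      by (simp add: matrix_mul_assoc SO3_transpose_mult)
    also have "\<dots> = mat 1"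
      using \<open>A z \<in> SO3\<close> by (simp add: eqs SO3_transpose_mult)
    \<comment> \<open>With \<open>R z = mat 1\<close> the base equation reads
      \<open>p z - u z = p z\<close>, which forces \<open>u z = 0\<close>.\<close>
    finally show ?thesis
      using eqs(1) by simp
  qed
  then show ?thesis
    unfolding *(4) gauge_group_one by (intro se3_gauge_cong) auto
qed

theorem proposition1:
  shows "transitive_right_action gauge_group cosserat_deformations cosserat_action \<and>
         free_right_action gauge_group cosserat_deformations cosserat_action"
  by (simp add: transitive_right_action_def transitive_right_action_axioms_def
      free_right_action_def free_right_action_axioms_def right_action_cosserat
      cosserat_action_transitive cosserat_action_free)

end
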